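(* If $G$ is a distance preserving graph with $|G|\ge 2$, then the lexicographic product $G[H]$ is distance preserving for any graph $H$.
   Context: All graphs are finite, undirected and simple, with nonempty vertex set; $|G|$ denotes the number of vertices of $G$. The distance $d_G(u,v)$ is the minimum length (number of edges) of a path from $u$ to $v$ in $G$, and $d_G(u,v)=\infty$ if no such path exists. A subgraph $K$ of $G$ is isometric if $d_K(u,v)=d_G(u,v)$ for every pair of vertices $u,v\in V(K)$. A graph $G$ is distance preserving (dp) if it is connected and has an isometric subgraph with exactly $i$ vertices for every $1\le i\le |G|$. The lexicographic product $G[H]$ is the graph with vertex set $V(G)\times V(H)$ and edge set $E(G[H])=\{(u,x)(v,y) : uv\in E(G),\text{ or } (xy\in E(H)\text{ and }u=v)\}$. *)

theory Defs
  imports "Graph_Theory.Graph_Theory" "HOL-Library.Extended_Nat"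
begin

text \<open>
  An undirected edge \<open>uv\<close> is represented by the two arcs \<open>(u,v)\<close> and \<open>(v,u)\<close>;
  \<^locale>\<open>pair_graph\<close> is a finite, symmetric, loop-free digraph without parallel arcs.
\<close>

locale simple_graph = pair_graph +
  assumes verts_nonempty: "pverts G \<noteq> {}"

text \<open>
  The infimum over the empty set is \<open>\<infinity>\<close> in \<^typ>\<open>enat\<close>; over a nonempty set it is the minimum.
\<close>

definition graph_dist :: "'a pair_pre_digraph \<Rightarrow> 'a \<Rightarrow> 'a \<Rightarrow> enat" where
  "graph_dist G u v = (INF p \<in> {p. pre_digraph.apath (with_proj G) u p v}. enat (length p))"

text \<open>
  \<^const>\<open>subgraph\<close> alone would allow keeping only one of the two arcs of an edge, hence the
  requirement that \<open>K\<close> is itself a graph.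
\<close>

definition isometric_subgraph :: "'a pair_pre_digraph \<Rightarrow> 'a pair_pre_digraph \<Rightarrow> bool" where
  "isometric_subgraph K G \<longleftrightarrow>
     simple_graph K \<and> subgraph (with_proj K) (with_proj G) \<and>
     (\<forall>u \<in> pverts K. \<forall>v \<in> pverts K. graph_dist K u v = graph_dist G u v)"

definition distance_preserving :: "'a pair_pre_digraph \<Rightarrow> bool" where
  "distance_preserving G \<longleftrightarrow>
     Digraph_Component.connected (with_proj G) \<and>
     (\<forall>i. 1 \<le> i \<and> i \<le> card (pverts G) \<longrightarrow>
        (\<exists>K. isometric_subgraph K G \<and> card (pverts K) = i))"

definition lex_product ::
    "'a pair_pre_digraph \<Rightarrow> 'b pair_pre_digraph \<Rightarrow> ('a \<times> 'b) pair_pre_digraph" where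
  "lex_product G H =
     \<lparr> pverts = pverts G \<times> pverts H,
       parcs = {((u, x), (v, y)) | u x v y.
                  (u, x) \<in> pverts G \<times> pverts H \<and> (v, y) \<in> pverts G \<times> pverts H \<and>
                  ((u, v) \<in> parcs G \<or> ((x, y) \<in> parcs H \<and> u = v))} \<rparr>"

lemma simple_graph_lex_product:
  assumes "simple_graph G" and "simple_graph H"
  shows "simple_graph (lex_product G H)"
proof -
  interpret G: simple_graph G by fact
  interpret H: simple_graph H by fact
  let ?V = "pverts G \<times> pverts H"
  have fin: "finite ?V"
    using G.pair_finite_verts H.pair_finite_verts by simp
  have "parcs (lex_product G H) \<subseteq> ?V \<times> ?V"
    by (auto simp: lex_product_def)
  then have "finite (parcs (lex_product G H))"
    using fin by (meson finite_SigmaI finite_subset)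
  moreover have "sym (parcs (lex_product G H))"
    by (auto simp: lex_product_def intro!: symI dest: G.arcs_symmetric H.arcs_symmetric)
  ultimately show ?thesis
    using fin G.verts_nonempty H.verts_nonempty
    by unfold_locales
      (auto simp: lex_product_def symmetric_def dest: G.no_loops' H.no_loops')
qed

end

theory Submission
  imports Defs
begin

text \<open>
  A walk of positive length in \<open>G\<close> lifts to a walk in \<open>G[H]\<close> of
  the same length with any prescribed end points above it, so distances between different fibres of
  \<open>G[H]\<close> are those of \<open>G\<close>, while two vertices of one fibre are at distance at most \<open>2\<close>, via a
  neighbouring fibre. Hence, for an isometric subgraph \<open>K\<close> of \<open>G\<close> with at least two vertices, every
  set of vertices of \<open>G[H]\<close> whose projection is exactly \<open>V(K)\<close> induces an isometric subgraph.
  Such sets have all sizes from \<open>|K|\<close> to \<open>|K||H|\<close>: take \<open>|K| = i\<close> if \<open>2 \<le> i \<le> |G|\<close>, and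
  \<open>|K| = |G|\<close> for larger \<open>i\<close>.
\<close>

section \<open>Distances through relation powers\<close>

lemma relpow_mono_rel:
  fixes R S :: "('a \<times> 'a) set"
  assumes "R \<subseteq> S"
  shows "R ^^ n \<subseteq> S ^^ n"
  using assms by (induction n) auto

text \<open>Each reduction step cuts a cycle \<open>r\<close> out of a walk
  \<open>q @ r @ s\<close>, which cannot lengthen it. Distances can therefore be measured by walks
  instead of paths.\<close>

lemma (in wf_digraph) length_awalk_to_apath_le:
  assumes "awalk u p v"
  shows "length (awalk_to_apath p) \<le> length p"
  using assms
proof (induct rule: awalk_to_apath_induct)
  case (path p)
  then have "awalk_to_apath p = p"
    by (auto simp: awalk_to_apath.simps)
  then show ?case by simp
next
  case (decomp p q r s)
  then have "length (q @ s) \<le> length p"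
    by (auto elim!: awalk_cyc_decompE)
  with decomp step_awalk_to_apath[of u p v q r s] show ?case by simp
qed

text \<open>The hypothesis matters at \<open>n = 0\<close>: the zeroth power is the identity on the
  whole type, whereas an empty walk has to start at a vertex.\<close>

lemma (in pair_wf_digraph) awalk_iff_relpow:
  assumes "u \<in> pverts G"
  shows "(\<exists>p. awalk u p v \<and> length p = n) \<longleftrightarrow> (u, v) \<in> parcs G ^^ n"
  using assms
proof (induction n arbitrary: u)
  case 0
  then show ?case by (auto simp: awalk_Nil_iff)
next
  case (Suc n)
  have "(\<exists>p. awalk u p v \<and> length p = Suc n) \<longleftrightarrow>
      (\<exists>w. (u, w) \<in> parcs G \<and> (\<exists>p. awalk w p v \<and> length p = n))"
  proof
    assume "\<exists>p. awalk u p v \<and> length p = Suc n"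
    then obtain e p where "awalk u (e # p) v" "length p = n"
      by (metis length_Suc_conv)
    then show "\<exists>w. (u, w) \<in> parcs G \<and> (\<exists>p. awalk w p v \<and> length p = n)"
      by (cases e) (auto simp: awalk_Cons_iff)
  next
    assume "\<exists>w. (u, w) \<in> parcs G \<and> (\<exists>p. awalk w p v \<and> length p = n)"
    then obtain w p where "(u, w) \<in> parcs G" "awalk w p v" "length p = n"
      by blast
    then show "\<exists>p. awalk u p v \<and> length p = Suc n"
      by (intro exI[of _ "(u, w) # p"]) (simp add: awalk_Cons_iff)
  qed
  also have "\<dots> \<longleftrightarrow> (\<exists>w. (u, w) \<in> parcs G \<and> (w, v) \<in> parcs G ^^ n)"
    using Suc.IH in_arcsD2 by blast
  also have "\<dots> \<longleftrightarrow> (u, v) \<in> parcs G ^^ Suc n"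
    by (meson relpow_Suc_D2 relpow_Suc_I2)
  finally show ?case .
qed

text \<open>If every value exceeds \<open>n\<close>, then \<open>Suc n\<close> is a lower bound. For
  empty \<open>A\<close> the infimum is infinite and both sides are false.\<close>

lemma enat_INF_le_iff:
  "(INF p\<in>A. enat (f p)) \<le> enat n \<longleftrightarrow> (\<exists>p\<in>A. f p \<le> n)"
proof
  assume le: "(INF p\<in>A. enat (f p)) \<le> enat n"
  show "\<exists>p\<in>A. f p \<le> n"
  proof (rule ccontr)
    assume "\<not> (\<exists>p\<in>A. f p \<le> n)"
    then have "enat (Suc n) \<le> (INF p\<in>A. enat (f p))"
      by (intro INF_greatest) (auto simp: not_le Suc_le_eq)
    then have "enat (Suc n) \<le> enat n" using le by (rule order_trans)
    then show False by simp
  qed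
next
  assume "\<exists>p\<in>A. f p \<le> n"
  then show "(INF p\<in>A. enat (f p)) \<le> enat n"
    by (auto intro: INF_lower2)
qed

text \<open>The bound \<open>m \<le> n\<close> absorbs the loss of length when a walk is cut down to
  a path. Unreachable pairs need no separate case.\<close>

lemma (in pair_wf_digraph) graph_dist_le_iff:
  assumes "u \<in> pverts G"
  shows "graph_dist G u v \<le> enat n \<longleftrightarrow> (\<exists>m\<le>n. (u, v) \<in> parcs G ^^ m)"
proof -
  have "graph_dist G u v \<le> enat n \<longleftrightarrow> (\<exists>p. apath u p v \<and> length p \<le> n)"
    by (simp add: graph_dist_def enat_INF_le_iff)
  also have "\<dots> \<longleftrightarrow> (\<exists>p. awalk u p v \<and> length p \<le> n)"
    by (meson apath_awalk_to_apath awalkI_apath length_awalk_to_apath_le order_trans)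
  also have "\<dots> \<longleftrightarrow> (\<exists>m\<le>n. (u, v) \<in> parcs G ^^ m)"
    using awalk_iff_relpow[OF assms] by metis
  finally show ?thesis .
qed

text \<open>Finite bounds suffice, since infinity is the only value that lies below none of
  them.\<close>

lemma enat_eqI_le_iff:
  fixes a b :: enat
  assumes "\<And>n. a \<le> enat n \<longleftrightarrow> b \<le> enat n"
  shows "a = b"
proof (rule antisym)
  show "a \<le> b" using assms by (cases b) auto
  show "b \<le> a" using assms by (cases a) auto
qed

lemma simple_graph_imp_pair_wf_digraph: "simple_graph G \<Longrightarrow> pair_wf_digraph G"
  by (simp add: simple_graph_def pair_graph_def pair_digraph.pair_wf_digraph)

text \<open>\<open>connected\<close> means strong connectedness of the symmetric closure, which adds
  no reachability because the arcs are already symmetric.\<close>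

lemma simple_graph_connected_iff:
  assumes "simple_graph G"
  shows "Digraph_Component.connected (with_proj G) \<longleftrightarrow>
    (\<forall>u\<in>pverts G. \<forall>v\<in>pverts G. \<exists>n. (u, v) \<in> parcs G ^^ n)"
proof -
  interpret simple_graph G by fact
  have "Digraph_Component.connected (with_proj G) \<longleftrightarrow>
      (\<forall>u\<in>pverts G. \<forall>v\<in>pverts G. u \<rightarrow>\<^sup>*\<^bsub>with_proj G\<^esub> v)"
    using reachable_mk_symmetric_eq[OF pair_sym_arcs] verts_nonempty
    by (simp add: connected_def strongly_connected_def)
  also have "\<dots> \<longleftrightarrow> (\<forall>u\<in>pverts G. \<forall>v\<in>pverts G. \<exists>n. (u, v) \<in> parcs G ^^ n)"
    using awalk_iff_relpow reachable_awalk by metis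
  finally show ?thesis .
qed

section \<open>Induced subgraphs of the lexicographic product\<close>

definition induced_pair_graph :: "'a pair_pre_digraph \<Rightarrow> 'a set \<Rightarrow> 'a pair_pre_digraph" where
  "induced_pair_graph G W = \<lparr> pverts = W, parcs = parcs G \<inter> W \<times> W \<rparr>"

lemma induced_pair_graph_simps [simp]:
  "pverts (induced_pair_graph G W) = W"
  "parcs (induced_pair_graph G W) = parcs G \<inter> W \<times> W"
  by (simp_all add: induced_pair_graph_def)

lemma simple_graph_induced_pair_graph:
  assumes "simple_graph G" "W \<subseteq> pverts G" "W \<noteq> {}"
  shows "simple_graph (induced_pair_graph G W)"
proof -
  interpret simple_graph G by fact
  have "finite W"
    using assms(2) pair_finite_verts by (rule finite_subset)
  with assms(3) show ?thesis
    using pair_finite_arcs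
    by unfold_locales
      (auto simp: symmetric_def intro!: symI dest: arcs_symmetric no_loops')
qed

lemma subgraph_induced_pair_graph:
  assumes "simple_graph G" "W \<subseteq> pverts G" "W \<noteq> {}"
  shows "subgraph (with_proj (induced_pair_graph G W)) (with_proj G)"
  using assms simple_graph_induced_pair_graph[OF assms]
  by (auto simp: subgraph_def wf_digraph_wp_iff simple_graph_imp_pair_wf_digraph)

lemma isometric_subgraph_singleton:
  assumes "simple_graph G" "u \<in> pverts G"
  shows "isometric_subgraph (induced_pair_graph G {u}) G"
proof -
  let ?K = "induced_pair_graph G {u}"
  have K: "simple_graph ?K"
    using assms by (intro simple_graph_induced_pair_graph) auto
  interpret G: pair_wf_digraph G
    using assms(1) by (rule simple_graph_imp_pair_wf_digraph)
  interpret K: pair_wf_digraph ?K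
    using K by (rule simple_graph_imp_pair_wf_digraph)
  have "graph_dist ?K u u = graph_dist G u u"
    using assms(2)
    by (intro enat_eqI_le_iff) (auto simp: G.graph_dist_le_iff K.graph_dist_le_iff intro!: exI[of _ 0])
  with K assms show ?thesis
    by (auto simp: isometric_subgraph_def intro!: subgraph_induced_pair_graph)
qed

section \<open>Walks in the lexicographic product\<close>

lemma pverts_lex_product [simp]: "pverts (lex_product G H) = pverts G \<times> pverts H"
  by (simp add: lex_product_def)

lemma lex_product_arc_iff:
  "((u, x), (v, y)) \<in> parcs (lex_product G H) \<longleftrightarrow>
    u \<in> pverts G \<and> v \<in> pverts G \<and> x \<in> pverts H \<and> y \<in> pverts H \<and>
    ((u, v) \<in> parcs G \<or> (x, y) \<in> parcs H \<and> u = v)"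
  by (auto simp: lex_product_def)

text \<open>Arcs inside a fibre project to a single vertex and drop out, so the projected walk may
  be shorter.\<close>

lemma lex_product_relpow_fst:
  assumes "(a, b) \<in> parcs (lex_product G H) ^^ n"
  shows "\<exists>m\<le>n. (fst a, fst b) \<in> parcs G ^^ m"
  using assms
proof (induction n arbitrary: b)
  case 0
  then show ?case by (auto intro!: exI[of _ 0])
next
  case (Suc n)
  then obtain c where c: "(a, c) \<in> parcs (lex_product G H) ^^ n" "(c, b) \<in> parcs (lex_product G H)"
    by auto
  with Suc.IH obtain m where m: "m \<le> n" "(fst a, fst c) \<in> parcs G ^^ m" by blast
  from c(2) have "(fst c, fst b) \<in> parcs G \<or> fst c = fst b"
    by (cases b; cases c) (auto simp: lex_product_arc_iff)
  with m show ?case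
    by (metis Suc_le_mono le_Suc_eq relpow_Suc_I)
qed

text \<open>An arc of \<open>K\<close> joins every vertex of one fibre to every vertex of the other,
  so inner vertices of the walk may be any elements of \<open>W\<close> over it; they exist because
  \<open>W\<close> projects onto \<open>K\<close>. Positive length is essential, as \<open>x\<close>
  and \<open>y\<close> may differ even if \<open>u = v\<close>.\<close>

lemma lex_product_relpow_lift:
  assumes "W \<subseteq> pverts G \<times> pverts H" "fst ` W = pverts K" "pair_wf_digraph K" "parcs K \<subseteq> parcs G"
    and "(u, v) \<in> parcs K ^^ n" "n > 0" "(u, x) \<in> W" "(v, y) \<in> W"
  shows "((u, x), (v, y)) \<in> parcs (induced_pair_graph (lex_product G H) W) ^^ n"
proof -
  have arc: "((u, x), (v, y)) \<in> parcs (induced_pair_graph (lex_product G H) W)"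
    if "(u, v) \<in> parcs K" "(u, x) \<in> W" "(v, y) \<in> W" for u x v y
    using that assms(1,4) by (auto simp: lex_product_arc_iff)
  show ?thesis
    using assms(5-8)
  proof (induction n arbitrary: u x)
    case 0
    then show ?case by simp
  next
    case (Suc n)
    show ?case
    \<comment> \<open>The last arc must end at the prescribed \<open>(v, y)\<close>, so the
      induction effectively starts at length one.\<close>
    proof (cases "n = 0")
      case True
      with Suc.prems arc show ?thesis by auto
    next
      case False
      from Suc.prems(1) obtain w where w: "(u, w) \<in> parcs K" "(w, v) \<in> parcs K ^^ n"
        by (meson relpow_Suc_D2)
      then have "w \<in> fst ` W"
        using assms(2,3) by (auto dest: pair_wf_digraph.in_arcsD2)
      then obtain z where z: "(w, z) \<in> W" by auto
      with w Suc False have "((w, z), (v, y)) \<in> parcs (induced_pair_graph (lex_product G H) W) ^^ n"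
        by blast
      with arc[OF w(1) Suc.prems(3) z] show ?thesis
        by (rule relpow_Suc_I2)
    qed
  qed
qed

text \<open>A walk to some other vertex starts with an arc to a neighbour; go there and
  back.\<close>

lemma simple_graph_walk_length_two:
  assumes "simple_graph K" "\<forall>u\<in>pverts K. \<forall>v\<in>pverts K. \<exists>n. (u, v) \<in> parcs K ^^ n"
    and "card (pverts K) \<ge> 2" "u \<in> pverts K"
  shows "(u, u) \<in> parcs K ^^ 2"
proof -
  interpret simple_graph K by fact
  have "\<not> pverts K \<subseteq> {u}"
    using assms(3) card_mono[of "{u}" "pverts K"] by auto
  then obtain v where v: "v \<in> pverts K" "v \<noteq> u"
    by auto
  with assms(2,4) obtain n where n: "(u, v) \<in> parcs K ^^ n" by blast
  with v(2) have "n \<noteq> 0" by (cases n) auto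
  with n obtain w where "(u, w) \<in> parcs K"
    by (metis not0_implies_Suc relpow_Suc_D2)
  then show ?thesis
    using arcs_symmetric by (auto simp: numeral_2_eq_2)
qed

lemma isometric_subgraph_lex_product:
  assumes G: "simple_graph G" and H: "simple_graph H"
    and conn: "Digraph_Component.connected (with_proj G)"
    and K: "isometric_subgraph K G" "card (pverts K) \<ge> 2"
    and W: "W \<subseteq> pverts G \<times> pverts H" "fst ` W = pverts K"
  shows "isometric_subgraph (induced_pair_graph (lex_product G H) W) (lex_product G H)"
proof -
  let ?P = "lex_product G H"
  let ?L = "induced_pair_graph ?P W"
  have K_simple: "simple_graph K"
    using K(1) by (simp add: isometric_subgraph_def)
  have KG: "pverts K \<subseteq> pverts G" "parcs K \<subseteq> parcs G"
    using K(1) by (auto simp: isometric_subgraph_def subgraph_def)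
  have P_simple: "simple_graph ?P"
    using G H by (rule simple_graph_lex_product)
  have "W \<noteq> {}"
    using K(2) W(2) by auto
  with W(1) P_simple have L_simple: "simple_graph ?L"
    by (intro simple_graph_induced_pair_graph) auto
  have L_sub: "subgraph (with_proj ?L) (with_proj ?P)"
    using W(1) P_simple \<open>W \<noteq> {}\<close> by (intro subgraph_induced_pair_graph) auto
  interpret G: pair_wf_digraph G using G by (rule simple_graph_imp_pair_wf_digraph)
  interpret K: pair_wf_digraph K using K_simple by (rule simple_graph_imp_pair_wf_digraph)
  interpret P: pair_wf_digraph ?P using P_simple by (rule simple_graph_imp_pair_wf_digraph)
  interpret L: pair_wf_digraph ?L using L_simple by (rule simple_graph_imp_pair_wf_digraph)

  have short: "\<exists>k\<le>m. (u, v) \<in> parcs K ^^ k"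
    if "u \<in> pverts K" "v \<in> pverts K" "(u, v) \<in> parcs G ^^ m" for u v m
  proof -
    have "graph_dist G u v \<le> enat m"
      using that(3) G.graph_dist_le_iff[OF subsetD[OF KG(1) that(1)]] by blast
    then have "graph_dist K u v \<le> enat m"
      using that K(1) by (simp add: isometric_subgraph_def)
    with that show ?thesis by (simp add: K.graph_dist_le_iff)
  qed
  \<comment> \<open>Isometry carries connectedness over from \<open>G\<close>, since finite
    distances stay finite.\<close>
  have K_conn: "\<forall>u\<in>pverts K. \<forall>v\<in>pverts K. \<exists>n. (u, v) \<in> parcs K ^^ n"
    using short conn KG(1) by (meson G simple_graph_connected_iff subsetD)

  have shorten: "\<exists>k\<le>n. ((u, x), (v, y)) \<in> parcs ?L ^^ k"
    if uv: "(u, x) \<in> W" "(v, y) \<in> W" and n: "((u, x), (v, y)) \<in> parcs ?P ^^ n" for u x v y n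
  proof (cases "u = v")
    \<comment> \<open>Different fibres: project the walk to \<open>G\<close>, replace it by one in
      \<open>K\<close> that is no longer, and lift that one into \<open>W\<close>.\<close>
    case False
    have mem: "u \<in> pverts K" "v \<in> pverts K"
      using uv W(2) by force+
    obtain m where "m \<le> n" "(u, v) \<in> parcs G ^^ m"
      using lex_product_relpow_fst[OF n] by auto
    with short mem obtain k where k: "k \<le> n" "(u, v) \<in> parcs K ^^ k"
      by (meson order_trans)
    with False have "k > 0" by (cases k) auto
    with k lex_product_relpow_lift[OF W K.pair_wf_digraph_axioms KG(2)] uv show ?thesis
      by blast
  next
    case True
    \<comment> \<open>Same fibre: lengths 0 and 1 survive in the induced subgraph, and any longer
      walk can be replaced by a detour of length two through a neighbouring fibre.\<close>
    consider "n = 0" | "n = 1" | "n \<ge> 2" by linarith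
    then show ?thesis
    proof cases
      case 1
      with n show ?thesis by auto
    next
      case 2
      with n uv show ?thesis by (intro exI[of _ 1]) auto
    next
      case 3
      have "u \<in> pverts K" using uv W(2) by force
      then have "(u, v) \<in> parcs K ^^ 2"
        using simple_graph_walk_length_two[OF K_simple K_conn K(2)] True by simp
      with 3 lex_product_relpow_lift[OF W K.pair_wf_digraph_axioms KG(2)] uv show ?thesis
        by (meson zero_less_numeral)
    qed
  qed
  have "graph_dist ?L a b = graph_dist ?P a b" if "a \<in> W" "b \<in> W" for a b
  proof (rule enat_eqI_le_iff)
    fix n
    have "(\<exists>m\<le>n. (a, b) \<in> parcs ?L ^^ m) \<longleftrightarrow> (\<exists>m\<le>n. (a, b) \<in> parcs ?P ^^ m)"
    proof
      assume "\<exists>m\<le>n. (a, b) \<in> parcs ?L ^^ m"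
      moreover have "parcs ?L ^^ m \<subseteq> parcs ?P ^^ m" for m
        by (rule relpow_mono_rel) auto
      ultimately show "\<exists>m\<le>n. (a, b) \<in> parcs ?P ^^ m" by blast
    next
      assume "\<exists>m\<le>n. (a, b) \<in> parcs ?P ^^ m"
      then obtain m where m: "m \<le> n" "(a, b) \<in> parcs ?P ^^ m" by blast
      then have "\<exists>k\<le>m. (a, b) \<in> parcs ?L ^^ k"
        using shorten[of "fst a" "snd a" "fst b" "snd b" m] that
        unfolding prod.collapse by blast
      with m(1) show "\<exists>m\<le>n. (a, b) \<in> parcs ?L ^^ m"
        by (blast intro: order_trans)
    qed
    moreover have "a \<in> pverts ?L" "a \<in> pverts ?P" using that W(1) by auto
    ultimately show "graph_dist ?L a b \<le> enat n \<longleftrightarrow> graph_dist ?P a b \<le> enat n"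
      by (simp only: L.graph_dist_le_iff P.graph_dist_le_iff)
  qed
  with L_simple L_sub show ?thesis
    by (simp add: isometric_subgraph_def)
qed

text \<open>Prefixing a closed walk of length two makes every walk of \<open>G\<close> positive in
  length, so lifting also joins vertices of one fibre.\<close>

lemma connected_lex_product:
  assumes G: "simple_graph G" and H: "simple_graph H"
    and conn: "Digraph_Component.connected (with_proj G)" and card: "card (pverts G) \<ge> 2"
  shows "Digraph_Component.connected (with_proj (lex_product G H))"
proof -
  interpret H: simple_graph H by fact
  let ?W = "pverts G \<times> pverts H"
  have G_conn: "\<forall>u\<in>pverts G. \<forall>v\<in>pverts G. \<exists>n. (u, v) \<in> parcs G ^^ n"
    using conn by (simp add: simple_graph_connected_iff[OF G])
  have walk: "\<exists>n>0. (u, v) \<in> parcs G ^^ n" if uv: "u \<in> pverts G" "v \<in> pverts G" for u v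
  proof -
    obtain n where "(u, v) \<in> parcs G ^^ n" using G_conn uv by blast
    with simple_graph_walk_length_two[OF G G_conn card uv(1)]
    have "(u, v) \<in> parcs G ^^ (2 + n)" by (rule relpow_trans)
    moreover have "2 + n > 0" by simp
    ultimately show ?thesis by blast
  qed
  have induced: "parcs (induced_pair_graph (lex_product G H) ?W) = parcs (lex_product G H)"
    by (auto simp: lex_product_arc_iff)
  have fst_W: "fst ` ?W = pverts G"
    using H.verts_nonempty by (simp add: fst_image_times)
  have "\<exists>n. ((u, x), (v, y)) \<in> parcs (lex_product G H) ^^ n"
    if mem: "(u, x) \<in> ?W" "(v, y) \<in> ?W" for u x v y
  proof -
    obtain n where "n > 0" "(u, v) \<in> parcs G ^^ n"
      using walk mem by blast
    then show ?thesis
      using lex_product_relpow_lift[OF subset_refl fst_W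
          simple_graph_imp_pair_wf_digraph[OF G] subset_refl] mem
      unfolding induced by blast
  qed
  then show ?thesis
    unfolding simple_graph_connected_iff[OF simple_graph_lex_product[OF G H]] pverts_lex_product
    by blast
qed

theorem corollary3p3:
  fixes G :: "'a pair_pre_digraph" and H :: "'b pair_pre_digraph"
  assumes "simple_graph G" and "simple_graph H"
    and "distance_preserving G" and "card (pverts G) \<ge> 2"
  shows "distance_preserving (lex_product G H)"
proof -
  interpret G: simple_graph G by fact
  interpret H: simple_graph H by fact
  have conn: "Digraph_Component.connected (with_proj G)"
    using assms(3) by (simp add: distance_preserving_def)
  obtain g h where gh: "g \<in> pverts G" "h \<in> pverts H"
    using G.verts_nonempty H.verts_nonempty by blast
  have "\<exists>K. isometric_subgraph K (lex_product G H) \<and> card (pverts K) = i"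
    if i: "1 \<le> i" "i \<le> card (pverts G) * card (pverts H)" for i
  \<comment> \<open>Size one is separate because the fibre argument needs a \<open>K\<close> with at
    least two vertices.\<close>
  proof (cases "i = 1")
    case True
    with isometric_subgraph_singleton[OF simple_graph_lex_product[OF assms(1,2)], of "(g, h)"] gh
    show ?thesis by fastforce
  next
    case False
    let ?k = "min i (card (pverts G))"
    have "1 \<le> ?k" "?k \<le> card (pverts G)" using i assms(4) by auto
    with assms(3) obtain K where K: "isometric_subgraph K G" "card (pverts K) = ?k"
      unfolding distance_preserving_def by blast
    have KG: "pverts K \<subseteq> pverts G"
      using K(1) by (auto simp: isometric_subgraph_def subgraph_def)
    then have fin: "finite (pverts K)"
      using G.pair_finite_verts finite_subset by blast
    have "card (pverts H) > 0"
      using gh H.pair_finite_verts by (auto simp: card_gt_0_iff)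
    \<comment> \<open>If \<open>i\<close> is at most the order of \<open>G\<close>, then
      \<open>?k = i\<close> and a nonempty \<open>H\<close> suffices; otherwise this is the upper
      bound on \<open>i\<close>.\<close>
    then have "i \<le> ?k * card (pverts H)"
      using i(2) by (cases "i \<le> card (pverts G)") (auto simp: min_def)
    \<comment> \<open>Containing the copy of \<open>K\<close> at height \<open>h\<close>, which has
      \<open>?k \<le> i\<close> vertices, forces \<open>W\<close> to project onto all of
      \<open>K\<close>.\<close>
    then obtain W where W: "pverts K \<times> {h} \<subseteq> W" "W \<subseteq> pverts K \<times> pverts H" "card W = i"
      using exists_subset_between[of "pverts K \<times> {h}" i "pverts K \<times> pverts H"]
        K(2) gh fin H.pair_finite_verts by (auto simp: card_cartesian_product)
    have "fst ` W = pverts K" using W(1,2) by force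
    moreover have "W \<subseteq> pverts G \<times> pverts H" using W(2) KG by auto
    moreover have "card (pverts K) \<ge> 2" using K(2) False i(1) assms(4) by auto
    ultimately have "isometric_subgraph (induced_pair_graph (lex_product G H) W) (lex_product G H)"
      using isometric_subgraph_lex_product[OF assms(1,2) conn K(1)] by blast
    with W(3) show ?thesis by auto
  qed
  with connected_lex_product[OF assms(1,2) conn assms(4)] show ?thesis
    by (simp add: distance_preserving_def card_cartesian_product)
qed

end
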